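(* Let $n\ge 1$, let $f_1,\dots,f_n:\mathsf H\to\mathbb R$ be functions on a separable real Hilbert space $\mathsf H$, let $F=\frac1n\sum_{i=1}^n f_i$, and assume $\operatorname{argmin}F\neq\varnothing$. Assume that each $f_i$ is convex and $L$-smooth for some $L>0$. Let $(\boldsymbol x^k)_{k\in\mathbb N}$ be generated by the SAPA algorithm described in the context with step size $\alpha$. Let $M\ge 2n$ and let $\alpha>0$ be such that $\alpha<\frac1{L(2+M/n)}$. Then, for all integers $k\ge1$, $$\mathsf E\big[F(\bar{\boldsymbol x}^k)-F_*\big]\le\frac{\operatorname{dist}(\boldsymbol x^0,\operatorname{argmin}F)^2+\alpha^2M\,\mathsf E[\sigma_0^2]}{2\alpha k\,[1-\alpha L(2+M/n)]},\qquad\bar{\boldsymbol x}^k=\frac1k\sum_{t=0}^{k-1}\boldsymbol x^t,$$ where $\sigma_0^2=\frac1n\sum_{i=1}^n\|\nabla f_i(\boldsymbol\phi_i^0)-\nabla f_i(\boldsymbol x^* )\|^2$ and $\boldsymbol x^*\in\operatorname{argmin}F$ is such that $\|\boldsymbol x^0-\boldsymbol x^*\|=\operatorname{dist}(\boldsymbol x^0,\operatorname{argmin}F)$.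
   Context: Notation: $F_*=\inf F$; $\operatorname{dist}(x,S)=\inf_{z\in S}\|x-z\|$; $\operatorname{prox}_{\varphi}(x)=\operatorname{argmin}_{y\in\mathsf H}\{\varphi(y)+\frac12\|y-x\|^2\}$; $\delta_{i,j}$ is the Kronecker symbol. A function $f$ is $L$-smooth if it is differentiable and $\|\nabla f(x)-\nabla f(y)\|\le L\|x-y\|$ for all $x,y\in\mathsf H$. SAPA algorithm: $(i_k)_{k\in\mathbb N}$ is a sequence of i.i.d. random variables uniformly distributed on $\{1,\dots,n\}$. Let $\alpha>0$ and set, for every $i\in\{1,\dots,n\}$, $\boldsymbol\phi_i^0=\boldsymbol x^0\in\mathsf H$ (deterministic). For $k=0,1,\dots$ $$\boldsymbol x^{k+1}=\operatorname{prox}_{\alpha f_{i_k}}\Big(\boldsymbol x^k+\alpha\nabla f_{i_k}(\boldsymbol\phi_{i_k}^k)-\frac\alpha n\sum_{i=1}^n\nabla f_i(\boldsymbol\phi_i^k)\Big),\qquad\boldsymbol\phi_i^{k+1}=\boldsymbol\phi_i^k+\delta_{i,i_k}(\boldsymbol x^k-\boldsymbol\phi_i^k)\ \text{ for all } i\in\{1,\dots,n\}.$$ *)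

theory Defs
  imports "HOL-Probability.Probability"
begin

text \<open>Separable real Hilbert spaces are rendered as the sort
  \<open>{real_inner, polish_space}\<close>: complete, and second countable, which for a metric space is
  the same as separable.\<close>

definition grad :: "('a::real_inner \<Rightarrow> real) \<Rightarrow> 'a \<Rightarrow> 'a" where
  "grad f x = (THE D. GDERIV f x :> D)"

definition smooth_with :: "real \<Rightarrow> ('a::real_inner \<Rightarrow> real) \<Rightarrow> bool" where
  "smooth_with L f \<longleftrightarrow>
     (\<forall>x. f differentiable (at x)) \<and>
     (\<forall>x y. norm (grad f x - grad f y) \<le> L * norm (x - y))"

definition argmin_set :: "('a \<Rightarrow> real) \<Rightarrow> 'a set" where
  "argmin_set f = {x. is_arg_min f (\<lambda>_. True) x}"

text \<open>The library's \<open>arg_min\<close> selects some minimizer. For convex and continuous \<open>\<phi>\<close>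
  on a Hilbert space the minimizer below exists and is unique.\<close>

definition prox :: "('a::real_inner \<Rightarrow> real) \<Rightarrow> 'a \<Rightarrow> 'a" where
  "prox \<phi> x = arg_min (\<lambda>y. \<phi> y + 1/2 * (norm (y - x))\<^sup>2) (\<lambda>_. True)"

end

theory Submission imports Defs begin

text \<open>Let \<open>\<sigma>\<close> measure the distance of the stored gradients \<open>\<nabla>f\<^sub>i(\<phi>\<^sub>i)\<close> from
  \<open>\<nabla>f\<^sub>i(x\<^sup>*)\<close>. A proximal step with error \<open>e\<close> satisfies
  \<open>\<parallel>x\<^sup>+ - x\<^sup>*\<parallel>\<^sup>2 \<le> \<parallel>x - x\<^sup>*\<parallel>\<^sup>2 - 2\<alpha>(f\<^sub>i(x) - f\<^sub>i(x\<^sup>*)) - 2\<alpha>\<langle>e, x - x\<^sup>*\<rangle> + \<alpha>\<^sup>2\<parallel>\<nabla>f\<^sub>i(x) + e\<parallel>\<^sup>2\<close>.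
  On average over \<open>i\<close> the error vanishes, and cocoercivity of the gradients bounds the last term by
  \<open>\<sigma>\<^sup>2\<close> and the gap \<open>F(x) - F\<^sub>*\<close>, so \<open>\<parallel>x - x\<^sup>*\<parallel>\<^sup>2 + \<alpha>\<^sup>2M\<sigma>\<^sup>2\<close> is a Lyapunov function whose
  expectation drops in each iteration by a multiple of the expected gap. Telescoping and Jensen's
  inequality give the rate. Since the iterates depend on finitely many indices with finitely many
  values each, every quantity involved is a bounded measurable function, and averaging over the
  fresh index only needs its independence from the past ones.\<close>

section \<open>Minimizers and gradients in a Hilbert space\<close>

text \<open>The quadratic term makes the objective strongly convex, so a minimizing sequence is
  Cauchy and its limit is a minimizer. Both the Riesz representation and the existence of proximal
  points rest on this.\<close>

lemma convex_plus_quadratic_has_minimizer: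
  fixes g :: "'a::{real_inner, complete_space} \<Rightarrow> real"
  assumes conv: "convex_on UNIV g" and cont: "continuous_on UNIV g"
    and lower: "\<And>y. c - K * norm (y - z) \<le> g y"
  shows "\<exists>p. is_arg_min (\<lambda>y. g y + 1/2 * (norm (y - z))\<^sup>2) (\<lambda>_. True) p"
proof -
  define h where "h y = g y + 1/2 * (norm (y - z))\<^sup>2" for y
  define m where "m = (INF y. h y)"
  have "c - K\<^sup>2 / 2 \<le> h y" for y
  proof -
    \<comment> \<open>Completing the square in \<open>norm (y - z)\<close> shows that the quadratic
      term outweighs the linear decrease allowed by \<open>lower\<close>.\<close>
    have "0 \<le> (norm (y - z) - K)\<^sup>2" by simp
    with lower[of y] show ?thesis by (simp add: h_def power2_diff algebra_simps)
  qed
  then have bdd: "bdd_below (range h)" by (meson bdd_below.I2)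
  have m_le: "m \<le> h y" for y
    unfolding m_def by (rule cINF_lower[OF bdd]) simp
  \<comment> \<open>The midpoint \<open>w\<close> has value at least \<open>m\<close>; the
    parallelogram law for \<open>a - z\<close> and \<open>b - z\<close> turns this into a distance
    bound for near-minimizers.\<close>
  have strong: "(norm (a - b))\<^sup>2 \<le> 4 * (h a + h b - 2 * m)" for a b
  proof -
    define w where "w = (1/2) *\<^sub>R a + (1/2) *\<^sub>R b"
    have "g w \<le> (1/2) * g a + (1/2) * g b"
      unfolding w_def using convex_onD[OF conv, of "1/2" a b] by simp
    moreover have "w - z = (1/2) *\<^sub>R ((a - z) + (b - z))"
      by (simp add: w_def scaleR_right_diff_distrib scaleR_add_right scaleR_half_double algebra_simps
            flip: scaleR_left.add)
    then have "4 * (norm (w - z))\<^sup>2 = (norm ((a - z) + (b - z)))\<^sup>2"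
      by (simp add: power_mult_distrib power_divide)
    moreover have "(norm ((a - z) + (b - z)))\<^sup>2 + (norm (a - b))\<^sup>2
        = 2 * (norm (a - z))\<^sup>2 + 2 * (norm (b - z))\<^sup>2"
      by (simp add: power2_norm_eq_inner inner_simps inner_commute)
    ultimately show ?thesis using m_le[of w] by (simp add: h_def)
  qed
  have "\<exists>y. h y < m + 1 / real (Suc j)" for j
    using cINF_less_iff[OF _ bdd, of "m + 1 / real (Suc j)"] by (auto simp flip: m_def)
  then obtain u where u: "\<And>j. h (u j) < m + 1 / real (Suc j)" by metis
  have "Cauchy u"
  proof (rule CauchyI)
    fix e :: real assume "e > 0"
    \<comment> \<open>Two values exceeding \<open>m\<close> by less than
      \<open>e\<^sup>2 / 8\<close> each, multiplied by the factor 4 of \<open>strong\<close>, give a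
      squared distance below \<open>e\<^sup>2\<close>.\<close>
    then obtain N where N: "N \<noteq> 0" "1 / real N < e\<^sup>2 / 8"
      by (metis divide_pos_pos ex_inverse_of_nat_less inverse_eq_divide less_irrefl zero_less_numeral zero_less_power)
    have "norm (u i - u j) < e" if "i \<ge> N" "j \<ge> N" for i j
    proof -
      have "1 / real (Suc i) \<le> 1 / real N" "1 / real (Suc j) \<le> 1 / real N"
        using that N by (auto intro!: divide_left_mono)
      then have "h (u i) < m + 1 / real N" "h (u j) < m + 1 / real N"
        using u[of i] u[of j] by (auto intro: less_le_trans)
      then have "h (u i) < m + e\<^sup>2 / 8" "h (u j) < m + e\<^sup>2 / 8"
        using N(2) by (auto intro: less_trans)
      then have "(norm (u i - u j))\<^sup>2 < e\<^sup>2"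
        using strong[of "u i" "u j"] by (simp add: field_simps)
      then show ?thesis using \<open>e > 0\<close> by (simp add: power_less_imp_less_base)
    qed
    then show "\<exists>N. \<forall>i\<ge>N. \<forall>j\<ge>N. norm (u i - u j) < e" by blast
  qed
  then obtain p where p: "u \<longlonglongrightarrow> p" using Cauchy_convergent convergent_def by blast
  have "isCont h p"
    using cont unfolding h_def by (intro continuous_intros) (simp add: continuous_on_eq_continuous_at)
  then have "(\<lambda>j. h (u j)) \<longlonglongrightarrow> h p" using p by (rule isCont_tendsto_compose)
  moreover have "(\<lambda>j. m + 1 / real (Suc j)) \<longlonglongrightarrow> m"
    using tendsto_add[OF tendsto_const LIMSEQ_Suc[OF lim_1_over_n], of m] by simp
  ultimately have "h p \<le> m"
    by (rule LIMSEQ_le) (use u in \<open>auto intro: less_imp_le\<close>)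
  then have "is_arg_min h (\<lambda>_. True) p"
    using order_trans[OF _ m_le] by (simp add: is_arg_min_linorder)
  then show ?thesis unfolding h_def by blast
qed

lemma GDERIV_half_square_dist:
  fixes p z :: "'a::real_inner"
  shows "GDERIV (\<lambda>y. 1/2 * (norm (y - z))\<^sup>2) p :> p - z"
  unfolding gderiv_def power2_norm_eq_inner
  by (auto intro!: derivative_eq_intros simp: inner_commute)

lemma riesz_representation:
  fixes T :: "'a::{real_inner, complete_space} \<Rightarrow> real"
  assumes T: "bounded_linear T"
  shows "\<exists>d. \<forall>h. T h = h \<bullet> d"
  \<comment> \<open>the representing vector minimizes \<open>1/2 * \<parallel>y\<parallel>\<^sup>2 - T y\<close>\<close>
proof -
  interpret T: bounded_linear T by fact
  obtain K where K: "\<And>y. norm (T y) \<le> norm y * K" using T.bounded by blast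
  have "convex_on UNIV (\<lambda>y. - T y)"
    by (auto simp: convex_on_def T.add T.scaleR algebra_simps)
  moreover have "continuous_on UNIV (\<lambda>y. - T y)"
    by (intro continuous_intros T.continuous_on)
  moreover have "0 - K * norm (y - 0) \<le> - T y" for y
    using K[of y] by (simp add: abs_le_iff mult.commute)
  ultimately obtain p where p: "is_arg_min (\<lambda>y. - T y + 1/2 * (norm (y - 0))\<^sup>2) (\<lambda>_. True) p"
    using convex_plus_quadratic_has_minimizer by blast
  have "((\<lambda>y. - T y + 1/2 * (norm (y - 0))\<^sup>2) has_derivative (\<lambda>h. - T h + h \<bullet> (p - 0))) (at p)"
    using GDERIV_half_square_dist[of 0 p] unfolding gderiv_def
    by (intro has_derivative_add has_derivative_minus T.has_derivative has_derivative_ident)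
  then have "(\<lambda>h. - T h + h \<bullet> (p - 0)) = (\<lambda>h. 0)"
    by (rule has_derivative_local_min) (use p in \<open>simp add: is_arg_min_linorder\<close>)
  then have "\<forall>h. T h = h \<bullet> p" by (metis add_eq_0_iff2 diff_zero minus_minus add.inverse_inverse)
  then show ?thesis by blast
qed

text \<open>\<open>grad\<close> is a definite description, so the representing vector must exist and
  be unique. Riesz gives existence; testing two candidates \<open>D\<close> and \<open>d\<close> on
  \<open>D - d\<close> gives uniqueness.\<close>

lemma GDERIV_grad:
  fixes f :: "'a::{real_inner, complete_space} \<Rightarrow> real"
  assumes "f differentiable (at x)"
  shows "GDERIV f x :> grad f x"
proof -
  obtain T where T: "(f has_derivative T) (at x)" using assms by (auto simp: differentiable_def)
  obtain d where "\<forall>h. T h = h \<bullet> d"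
    using riesz_representation[OF has_derivative_bounded_linear[OF T]] by blast
  then have "GDERIV f x :> d" using T by (simp add: gderiv_def flip: fun_eq_iff)
  moreover have "D = d" if "GDERIV f x :> D" for D
  proof -
    have "(\<lambda>h. h \<bullet> D) = (\<lambda>h. h \<bullet> d)"
      using that \<open>GDERIV f x :> d\<close> unfolding gderiv_def by (rule has_derivative_unique)
    then have "(D - d) \<bullet> (D - d) = 0" by (metis inner_diff_right right_minus_eq)
    then show ?thesis by simp
  qed
  ultimately show ?thesis unfolding grad_def by (metis theI)
qed

section \<open>Inequalities for convex and smooth functions\<close>

lemma GDERIV_along_line:
  assumes "GDERIV f (x + t *\<^sub>R d) :> D"
  shows "((\<lambda>s. f (x + s *\<^sub>R d)) has_real_derivative d \<bullet> D) (at t)"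
proof -
  have "((\<lambda>s. x + s *\<^sub>R d) has_derivative (\<lambda>s. s *\<^sub>R d)) (at t)"
    by (auto intro!: derivative_eq_intros)
  from has_derivative_compose[OF this assms[unfolded gderiv_def]]
  show ?thesis by (simp add: has_field_derivative_def mult.commute[of "d \<bullet> D"] mult_commute_abs)
qed

text \<open>Otherwise \<open>q\<close>, which is \<open>f\<close> along the segment less the
  increase of the chord, has a positive derivative at 0, whereas convexity keeps
  \<open>q t \<le> q 0\<close> for \<open>t\<close> in the unit interval.\<close>

lemma convex_above_tangent:
  assumes conv: "convex_on UNIV f" and D: "GDERIV f x :> D"
  shows "f x + (y - x) \<bullet> D \<le> f y"
proof (rule ccontr)
  assume neg: "\<not> ?thesis"
  define q where "q t = f (x + t *\<^sub>R (y - x)) - t * (f y - f x)" for t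
  have "(q has_real_derivative (y - x) \<bullet> D - (f y - f x)) (at 0)"
    unfolding q_def using GDERIV_along_line[of f x 0 "y - x" D] D
    by (auto intro!: derivative_eq_intros)
  moreover have "(y - x) \<bullet> D - (f y - f x) > 0" using neg by simp
  ultimately obtain e where e: "e > 0" "\<And>h. 0 < h \<Longrightarrow> h < e \<Longrightarrow> q 0 < q (0 + h)"
    using DERIV_pos_inc_right by metis
  define t where "t = min 1 (e / 2)"
  have t: "0 < t" "t < e" "t \<le> 1" using e(1) by (auto simp: t_def)
  have "f ((1 - t) *\<^sub>R x + t *\<^sub>R y) \<le> (1 - t) * f x + t * f y"
    using conv t by (intro convex_onD) auto
  moreover have "(1 - t) *\<^sub>R x + t *\<^sub>R y = x + t *\<^sub>R (y - x)" by (simp add: algebra_simps)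
  ultimately have "q t \<le> q 0" by (simp add: q_def algebra_simps)
  with e(2)[of t] t show False by simp
qed

text \<open>Subtracting the linear and quadratic terms of the bound from \<open>f\<close> along the
  segment leaves \<open>q\<close>, whose derivative is nonpositive by Cauchy-Schwarz and the
  Lipschitz bound.\<close>

lemma descent_lemma:
  fixes f :: "'a::real_inner \<Rightarrow> real"
  assumes grad: "\<And>y. GDERIV f y :> G y"
    and lip: "\<And>x y. norm (G x - G y) \<le> L * norm (x - y)"
  shows "f (x + d) \<le> f x + d \<bullet> G x + L / 2 * (norm d)\<^sup>2"
proof -
  define q where "q t = f (x + t *\<^sub>R d) - t * (d \<bullet> G x) - L / 2 * (norm d)\<^sup>2 * t\<^sup>2" for t
  have deriv: "(q has_real_derivative d \<bullet> G (x + t *\<^sub>R d) - d \<bullet> G x - L * (norm d)\<^sup>2 * t) (at t)" for t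
    unfolding q_def using GDERIV_along_line[where f = f and x = x and d = d and t = t, OF grad]
    by (auto intro!: derivative_eq_intros)
  have "d \<bullet> G (x + t *\<^sub>R d) - d \<bullet> G x - L * (norm d)\<^sup>2 * t \<le> 0" if "t \<ge> 0" for t
  proof -
    have "d \<bullet> (G (x + t *\<^sub>R d) - G x) \<le> norm d * norm (G (x + t *\<^sub>R d) - G x)"
      by (rule norm_cauchy_schwarz)
    also have "\<dots> \<le> norm d * (L * norm (t *\<^sub>R d))"
      using lip[of "x + t *\<^sub>R d" x] by (intro mult_left_mono) auto
    finally show ?thesis using that by (simp add: inner_diff_right power2_eq_square mult_ac)
  qed
  with deriv have "\<exists>y. (q has_real_derivative y) (at t) \<and> y \<le> 0" if "t \<ge> 0" for t
    using that by blast
  then have "q 1 \<le> q 0"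
    by (intro DERIV_nonpos_imp_nonincreasing[of 0 1 q]) simp_all
  then show ?thesis by (simp add: q_def)
qed

text \<open>Cocoercivity in terms of function values: at \<open>x + d\<close> the tangent of
  \<open>f\<close> at \<open>y\<close> lies below the quadratic upper bound of \<open>f\<close>
  around \<open>x\<close>.\<close>

lemma smooth_convex_grad_diff:
  fixes f :: "'a::real_inner \<Rightarrow> real"
  assumes conv: "convex_on UNIV f" and L: "L > 0"
    and grad: "\<And>y. GDERIV f y :> G y"
    and lip: "\<And>x y. norm (G x - G y) \<le> L * norm (x - y)"
  shows "(norm (G x - G y))\<^sup>2 \<le> 2 * L * (f x - f y - (x - y) \<bullet> G y)"
proof -
  define u where "u = G x - G y"
  \<comment> \<open>This \<open>d\<close> minimizes
    \<open>d \<bullet> u + L / 2 * (norm d)\<^sup>2\<close>: a gradient step of size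
    \<open>1 / L\<close> for \<open>f\<close> minus its tangent at \<open>y\<close>.\<close>
  define d where "d = - ((1 / L) *\<^sub>R u)"
  have "f y + (x + d - y) \<bullet> G y \<le> f (x + d)"
    by (rule convex_above_tangent[OF conv grad])
  also have "\<dots> \<le> f x + d \<bullet> G x + L / 2 * (norm d)\<^sup>2"
    by (rule descent_lemma[OF grad lip])
  also have "d \<bullet> G x = d \<bullet> u + d \<bullet> G y" by (simp add: u_def inner_diff_right)
  finally have "f y + (x - y) \<bullet> G y \<le> f x + d \<bullet> u + L / 2 * (norm d)\<^sup>2"
    by (simp add: inner_simps)
  moreover have "d \<bullet> u = - (norm u)\<^sup>2 / L"
    by (simp add: d_def power2_norm_eq_inner)
  moreover have "L / 2 * (norm d)\<^sup>2 = (norm u)\<^sup>2 / (2 * L)"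
    using L by (simp add: d_def power_mult_distrib power_divide power2_eq_square)
  ultimately have "(norm u)\<^sup>2 / (2 * L) \<le> f x - f y - (x - y) \<bullet> G y"
    by (simp add: field_simps)
  then show ?thesis using L by (simp add: u_def field_simps)
qed

section \<open>The proximal step and one iteration averaged over the index\<close>

text \<open>\<open>prox\<close> chooses some minimizer, so existence comes first: the tangent of
  \<open>f\<close> at \<open>z\<close> supplies the linear lower bound. The equation then says that
  the derivative vanishes at the chosen point.\<close>

lemma prox_optimality:
  fixes f :: "'a::{real_inner, complete_space} \<Rightarrow> real"
  assumes conv: "convex_on UNIV f" and grad: "\<And>y. GDERIV f y :> G y" and \<alpha>: "\<alpha> \<ge> 0"
  shows "z - prox (\<lambda>y. \<alpha> * f y) z = \<alpha> *\<^sub>R G (prox (\<lambda>y. \<alpha> * f y) z)"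
proof -
  define p where "p = prox (\<lambda>y. \<alpha> * f y) z"
  let ?h = "\<lambda>y. \<alpha> * f y + 1/2 * (norm (y - z))\<^sup>2"
  have "convex_on UNIV (\<lambda>y. \<alpha> * f y)" using conv \<alpha> by (intro convex_on_cmul) auto
  moreover have "isCont f y" for y
    using grad[of y] unfolding gderiv_def by (rule has_derivative_continuous)
  then have "continuous_on UNIV (\<lambda>y. \<alpha> * f y)"
    by (intro continuous_intros) (simp add: continuous_on_eq_continuous_at)
  moreover have "\<alpha> * f z - (\<alpha> * norm (G z)) * norm (y - z) \<le> \<alpha> * f y" for y
  proof -
    have "f z + (y - z) \<bullet> G z \<le> f y" by (rule convex_above_tangent[OF conv grad])
    moreover have "- (norm (y - z) * norm (G z)) \<le> (y - z) \<bullet> G z"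
      using Cauchy_Schwarz_ineq2[of "y - z" "G z"] by linarith
    ultimately have "f z - norm (y - z) * norm (G z) \<le> f y" by linarith
    from mult_left_mono[OF this \<alpha>] show ?thesis by (simp add: algebra_simps)
  qed
  ultimately have "\<exists>p. is_arg_min ?h (\<lambda>_. True) p"
    by (rule convex_plus_quadratic_has_minimizer)
  then have min: "is_arg_min ?h (\<lambda>_. True) p"
    unfolding p_def prox_def arg_min_def by (rule someI_ex)
  have "(?h has_derivative (\<lambda>h. \<alpha> * (h \<bullet> G p) + h \<bullet> (p - z))) (at p)"
    using grad[of p] GDERIV_half_square_dist[of z p] unfolding gderiv_def
    by (intro has_derivative_add has_derivative_mult_right)
  then have "(\<lambda>h. \<alpha> * (h \<bullet> G p) + h \<bullet> (p - z)) = (\<lambda>h. 0)"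
    by (rule has_derivative_local_min) (use min in \<open>simp add: is_arg_min_linorder\<close>)
  \<comment> \<open>Evaluating the derivative at its own representing vector shows that this vector
    is zero.\<close>
  from fun_cong[OF this, of "\<alpha> *\<^sub>R G p + (p - z)"]
  have "(\<alpha> *\<^sub>R G p + (p - z)) \<bullet> (\<alpha> *\<^sub>R G p + (p - z)) = 0"
    by (simp add: inner_add_right)
  then have "\<alpha> *\<^sub>R G p + (p - z) = 0" by (simp only: inner_eq_zero_iff)
  then show ?thesis by (simp add: p_def algebra_simps)
qed

text \<open>In SAPA, \<open>e\<close> is the mean of the stored gradients minus the stored gradient
  of the drawn index. The right-hand side is free of the new point, so it can be averaged over the
  index.\<close>

lemma prox_step:
  fixes f :: "'a::{real_inner, complete_space} \<Rightarrow> real"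
  assumes conv: "convex_on UNIV f" and grad: "\<And>y. GDERIV f y :> G y" and \<alpha>: "\<alpha> \<ge> 0"
  shows "(norm (prox (\<lambda>y. \<alpha> * f y) (x - \<alpha> *\<^sub>R e) - s))\<^sup>2
    \<le> (norm (x - s))\<^sup>2 - 2 * \<alpha> * (f x - f s) - 2 * \<alpha> * (e \<bullet> (x - s)) + \<alpha>\<^sup>2 * (norm (G x + e))\<^sup>2"
proof -
  define p where "p = prox (\<lambda>y. \<alpha> * f y) (x - \<alpha> *\<^sub>R e)"
  have opt: "x - p = \<alpha> *\<^sub>R (G p + e)"
    using prox_optimality[OF conv grad \<alpha>, of "x - \<alpha> *\<^sub>R e"] by (simp add: p_def algebra_simps)
  \<comment> \<open>The first tangent compares the new point with \<open>s\<close>; the second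
    trades \<open>f p\<close> for \<open>f x\<close>.\<close>
  have tangents: "f p + (s - p) \<bullet> G p \<le> f s" "f x + (p - x) \<bullet> G x \<le> f p"
    by (rule convex_above_tangent[OF conv grad])+
  have "(norm (p - s))\<^sup>2 = (norm (x - s))\<^sup>2 - 2 * ((x - p) \<bullet> (p - s)) - (norm (p - x))\<^sup>2"
    by (simp add: power2_norm_eq_inner inner_simps inner_commute)
  also have "(x - p) \<bullet> (p - s) = \<alpha> * ((p - s) \<bullet> G p + (p - s) \<bullet> e)"
    by (simp add: opt inner_simps inner_commute)
  finally have "(norm (p - s))\<^sup>2 = (norm (x - s))\<^sup>2 - 2 * \<alpha> * ((p - s) \<bullet> G p)
      - 2 * \<alpha> * ((p - s) \<bullet> e) - (norm (p - x))\<^sup>2" by (simp add: algebra_simps)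
  moreover have "\<alpha> * (f x - f s) + \<alpha> * ((p - x) \<bullet> G x) \<le> \<alpha> * ((p - s) \<bullet> G p)"
    using tangents mult_left_mono[OF _ \<alpha>, of "f x - f s + (p - x) \<bullet> G x" "(p - s) \<bullet> G p"]
    by (simp add: inner_simps algebra_simps)
  moreover have "\<alpha> * ((p - s) \<bullet> e) = \<alpha> * ((p - x) \<bullet> e) + \<alpha> * (e \<bullet> (x - s))"
    by (simp add: inner_simps inner_commute algebra_simps)
  \<comment> \<open>Completing the square: \<open>- (norm (p - x))\<^sup>2\<close> absorbs all terms
    linear in \<open>p - x\<close>, at the price of the last term of the claim.\<close>
  moreover have "0 \<le> (norm ((p - x) + \<alpha> *\<^sub>R (G x + e)))\<^sup>2" by simp
  then have "0 \<le> (norm (p - x))\<^sup>2 + 2 * \<alpha> * ((p - x) \<bullet> G x) + 2 * \<alpha> * ((p - x) \<bullet> e)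
      + \<alpha>\<^sup>2 * (norm (G x + e))\<^sup>2"
    unfolding power2_norm_eq_inner by (simp add: inner_simps inner_commute power2_eq_square algebra_simps)
  moreover have "2 * \<alpha> * (f x - f s) = 2 * (\<alpha> * (f x - f s))" by simp
  ultimately show ?thesis unfolding p_def[symmetric] by linarith
qed

text \<open>Variance is at most the second moment, \<open>v\<close> being the mean of the
  family.\<close>

lemma sum_norm_diff_mean_le:
  fixes c :: "'i \<Rightarrow> 'a::real_inner"
  assumes v: "real (card I) *\<^sub>R v = (\<Sum>i\<in>I. c i)"
  shows "(\<Sum>i\<in>I. (norm (c i - v))\<^sup>2) \<le> (\<Sum>i\<in>I. (norm (c i))\<^sup>2)"
proof -
  have "(\<Sum>i\<in>I. (norm (c i - v))\<^sup>2) = (\<Sum>i\<in>I. (norm (c i))\<^sup>2 - 2 * (c i \<bullet> v) + (norm v)\<^sup>2)"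
    by (intro sum.cong) (simp_all add: power2_norm_eq_inner inner_simps inner_commute)
  also have "\<dots> = (\<Sum>i\<in>I. (norm (c i))\<^sup>2) - 2 * ((\<Sum>i\<in>I. c i) \<bullet> v) + real (card I) * (norm v)\<^sup>2"
    by (simp add: sum.distrib sum_subtractf sum_distrib_left inner_sum_left)
  also have "\<dots> = (\<Sum>i\<in>I. (norm (c i))\<^sup>2) - real (card I) * (norm v)\<^sup>2"
    by (simp add: power2_norm_eq_inner flip: v)
  finally show ?thesis by simp
qed

text \<open>The left-hand side is the conditional expectation of the next Lyapunov value given the
  current point and memory. In the factor \<open>2 + M / real n\<close>, the 2 stems from the
  proximal steps and \<open>M / real n\<close> from the refreshed memory.\<close>

lemma sapa_step:
  fixes f :: "nat \<Rightarrow> 'a::{real_inner, complete_space} \<Rightarrow> real"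
  assumes n: "n \<ge> 1"
    and conv: "\<And>i. i \<in> {1..n} \<Longrightarrow> convex_on UNIV (f i)"
    and grad: "\<And>i y. i \<in> {1..n} \<Longrightarrow> GDERIV (f i) y :> G i y"
    and lip: "\<And>i y z. i \<in> {1..n} \<Longrightarrow> norm (G i y - G i z) \<le> L * norm (y - z)"
    and L: "L > 0" and \<alpha>: "\<alpha> \<ge> 0" and M: "M \<ge> 2 * real n"
    and s: "(\<Sum>i=1..n. G i s) = 0"
  shows "1 / real n * (\<Sum>i=1..n.
        (norm (prox (\<lambda>y. \<alpha> * f i y)
           (x + \<alpha> *\<^sub>R G i (\<phi> i) - (\<alpha> / real n) *\<^sub>R (\<Sum>j=1..n. G j (\<phi> j))) - s))\<^sup>2
        + \<alpha>\<^sup>2 * M * (1 / real n * (\<Sum>j=1..n.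
            (norm (G j (\<phi> j + (if j = i then 1 else 0) *\<^sub>R (x - \<phi> j)) - G j s))\<^sup>2)))
    \<le> (norm (x - s))\<^sup>2 + \<alpha>\<^sup>2 * M * (1 / real n * (\<Sum>j=1..n. (norm (G j (\<phi> j) - G j s))\<^sup>2))
      - 2 * \<alpha> * (1 - \<alpha> * L * (2 + M / real n)) * (1 / real n * (\<Sum>j=1..n. f j x - f j s))"
proof -
  let ?I = "{1..n}"
  define v where "v = (1 / real n) *\<^sub>R (\<Sum>j\<in>?I. G j (\<phi> j))"
  define c where "c i = G i (\<phi> i) - G i s" for i
  define d where "d i = G i x - G i s" for i
  define e where "e i = v - G i (\<phi> i)" for i
  define p where "p i = prox (\<lambda>y. \<alpha> * f i y) (x - \<alpha> *\<^sub>R e i)" for i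
  define a where "a = (\<Sum>i\<in>?I. (norm (c i))\<^sup>2)"
  define b where "b = (\<Sum>i\<in>?I. (norm (d i))\<^sup>2)"
  define D where "D = (\<Sum>i\<in>?I. f i x - f i s)"
  define R where "R i = (\<Sum>j=1..n.
    (norm (G j (\<phi> j + (if j = i then 1 else 0) *\<^sub>R (x - \<phi> j)) - G j s))\<^sup>2)" for i
  have nv: "real n *\<^sub>R v = (\<Sum>i\<in>?I. G i (\<phi> i))" using n by (simp add: v_def)
  then have nc: "real (card ?I) *\<^sub>R v = (\<Sum>i\<in>?I. c i)"
    using s by (simp add: c_def sum_subtractf)
  have e0: "(\<Sum>i\<in>?I. e i) = 0" using nv by (simp add: e_def sum_subtractf sum_constant_scaleR)
  \<comment> \<open>The vector is the fresh deviation \<open>d i\<close> minus the centred stored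
    deviation \<open>c i - v\<close>.\<close>
  have w: "(norm (G i x + e i))\<^sup>2 \<le> 2 * (norm (d i))\<^sup>2 + 2 * (norm (c i - v))\<^sup>2" for i
  proof -
    have "G i x + e i = d i - (c i - v)" by (simp add: d_def c_def e_def)
    moreover have "0 \<le> (norm (d i + (c i - v)))\<^sup>2" by simp
    ultimately show ?thesis
      unfolding power2_norm_eq_inner by (simp add: inner_simps inner_commute)
  qed
  have "(\<Sum>i\<in>?I. (norm (p i - s))\<^sup>2) \<le> (\<Sum>i\<in>?I. (norm (x - s))\<^sup>2 - 2 * \<alpha> * (f i x - f i s)
      - 2 * \<alpha> * (e i \<bullet> (x - s)) + \<alpha>\<^sup>2 * (2 * (norm (d i))\<^sup>2 + 2 * (norm (c i - v))\<^sup>2))"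
  proof (rule sum_mono)
    fix i assume i: "i \<in> ?I"
    have "\<alpha>\<^sup>2 * (norm (G i x + e i))\<^sup>2 \<le> \<alpha>\<^sup>2 * (2 * (norm (d i))\<^sup>2 + 2 * (norm (c i - v))\<^sup>2)"
      by (intro mult_left_mono w) simp
    then show "(norm (p i - s))\<^sup>2 \<le> (norm (x - s))\<^sup>2 - 2 * \<alpha> * (f i x - f i s)
      - 2 * \<alpha> * (e i \<bullet> (x - s)) + \<alpha>\<^sup>2 * (2 * (norm (d i))\<^sup>2 + 2 * (norm (c i - v))\<^sup>2)"
      using prox_step[OF conv[OF i] grad[OF i] \<alpha>, of x "e i" s] unfolding p_def by linarith
  qed
  also have "\<dots> = real n * (norm (x - s))\<^sup>2 - 2 * \<alpha> * D - 2 * \<alpha> * ((\<Sum>i\<in>?I. e i) \<bullet> (x - s))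
      + \<alpha>\<^sup>2 * (2 * b + 2 * (\<Sum>i\<in>?I. (norm (c i - v))\<^sup>2))"
    by (simp add: sum.distrib sum_subtractf D_def b_def inner_sum_left flip: sum_distrib_left)
  \<comment> \<open>The errors cancel by \<open>e0\<close>, and the variance bound removes the
    centring.\<close>
  also have "\<dots> \<le> real n * (norm (x - s))\<^sup>2 - 2 * \<alpha> * D + \<alpha>\<^sup>2 * (2 * b + 2 * a)"
    unfolding e0 a_def using mult_left_mono[OF sum_norm_diff_mean_le[OF nc], of "\<alpha>\<^sup>2"]
    by (simp add: algebra_simps)
  finally have P: "(\<Sum>i\<in>?I. (norm (p i - s))\<^sup>2)
    \<le> real n * (norm (x - s))\<^sup>2 - 2 * \<alpha> * D + \<alpha>\<^sup>2 * (2 * b + 2 * a)" .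
  \<comment> \<open>Drawing \<open>i\<close> overwrites slot \<open>i\<close> alone; averaged over
    \<open>i\<close>, the memory sum moves the fraction \<open>1 / real n\<close> of the way from
    \<open>a\<close> to \<open>b\<close>.\<close>
  have "R i = a + ((norm (d i))\<^sup>2 - (norm (c i))\<^sup>2)" if i: "i \<in> ?I" for i
  proof -
    have "R i = (\<Sum>j\<in>?I. (norm (c j))\<^sup>2 + (if j = i then (norm (d j))\<^sup>2 - (norm (c j))\<^sup>2 else 0))"
      unfolding R_def by (intro sum.cong) (auto simp: c_def d_def)
    then show ?thesis using i by (simp add: sum.distrib a_def)
  qed
  then have "(\<Sum>i\<in>?I. R i) = real n * a + (b - a)"
    by (simp add: sum.distrib sum_subtractf a_def b_def)
  then have "1 / real n * (\<Sum>i\<in>?I. R i) = a + (b - a) / real n"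
    using n by (simp add: add_divide_distrib)
  then have Q: "(\<Sum>i\<in>?I. \<alpha>\<^sup>2 * M * (1 / real n * R i)) = \<alpha>\<^sup>2 * (M * a + M / real n * (b - a))"
    unfolding sum_distrib_left[symmetric] by (simp add: algebra_simps)
  \<comment> \<open>Cocoercivity summed over the indices; the linear terms cancel because the
    gradients at \<open>s\<close> sum to zero.\<close>
  have "b \<le> (\<Sum>i\<in>?I. 2 * L * (f i x - f i s - (x - s) \<bullet> G i s))"
    unfolding b_def d_def by (intro sum_mono smooth_convex_grad_diff conv L grad lip)
  also have "\<dots> = 2 * L * D"
    using s by (simp add: D_def sum_subtractf flip: sum_distrib_left inner_sum_right)
  finally have "b \<le> 2 * L * D" .
  \<comment> \<open>The condition on \<open>M\<close> lets the memory decrease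
    \<open>M / real n * a\<close> pay for the \<open>2 * a\<close> of the proximal steps.\<close>
  have "2 \<le> M / real n" using M n by (simp add: field_simps)
  then have "(2 + M / real n) * b \<le> (2 + M / real n) * (2 * L * D)" 
    by (intro mult_left_mono \<open>b \<le> 2 * L * D\<close>) simp
  moreover have "0 \<le> a" by (simp add: a_def sum_nonneg)
  then have "2 * a \<le> M / real n * a" using \<open>2 \<le> M / real n\<close> by (rule mult_right_mono[rotated])
  ultimately have "2 * b + 2 * a + M / real n * (b - a) \<le> (2 + M / real n) * (2 * L * D)"
    by (simp add: algebra_simps diff_divide_distrib)
  from mult_left_mono[OF this, of "\<alpha>\<^sup>2"] P Q
  have "(\<Sum>i\<in>?I. (norm (p i - s))\<^sup>2) + (\<Sum>i\<in>?I. \<alpha>\<^sup>2 * M * (1 / real n * R i))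
    \<le> real n * (norm (x - s))\<^sup>2 + \<alpha>\<^sup>2 * M * a
      - 2 * \<alpha> * (1 - \<alpha> * L * (2 + M / real n)) * D"
    by (simp add: algebra_simps diff_divide_distrib power2_eq_square)
  from mult_left_mono[OF this, of "1 / real n"]
  have "1 / real n * (\<Sum>i\<in>?I. (norm (p i - s))\<^sup>2 + \<alpha>\<^sup>2 * M * (1 / real n * R i))
    \<le> 1 / real n * (real n * (norm (x - s))\<^sup>2 + \<alpha>\<^sup>2 * M * a
      - 2 * \<alpha> * (1 - \<alpha> * L * (2 + M / real n)) * D)"
    by (simp only: sum.distrib) simp
  also have "\<dots> = (norm (x - s))\<^sup>2 + \<alpha>\<^sup>2 * M * (1 / real n * a)
      - 2 * \<alpha> * (1 - \<alpha> * L * (2 + M / real n)) * (1 / real n * D)"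
    using n by (simp add: diff_divide_distrib add_divide_distrib)
  also have "p = (\<lambda>i. prox (\<lambda>y. \<alpha> * f i y)
           (x + \<alpha> *\<^sub>R G i (\<phi> i) - (\<alpha> / real n) *\<^sub>R (\<Sum>j=1..n. G j (\<phi> j))))"
    by (simp add: fun_eq_iff p_def e_def v_def algebra_simps)
  finally show ?thesis unfolding R_def a_def D_def c_def .
qed

section \<open>Random variables determined by past indices\<close>

text \<open>Adaptedness stated pointwise, so that it can be checked for the iterates without
  discussing measurability of \<open>grad\<close> or \<open>prox\<close>.\<close>

definition history_determined :: "'w measure \<Rightarrow> (nat \<Rightarrow> 'w \<Rightarrow> 'b) \<Rightarrow> nat \<Rightarrow> ('w \<Rightarrow> 'c) \<Rightarrow> bool" where
  "history_determined P X t g \<longleftrightarrow>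
     (\<forall>\<omega>\<in>space P. \<forall>\<omega>'\<in>space P. (\<forall>s<t. X s \<omega> = X s \<omega>') \<longrightarrow> g \<omega> = g \<omega>')"

text \<open>A Doob-Dynkin factorization by choice: \<open>H\<close> evaluates \<open>g\<close> at
  some sample point with the given history.\<close>

lemma history_determined_factor:
  assumes "history_determined P X t g"
  obtains H where "\<And>\<omega>. \<omega> \<in> space P \<Longrightarrow> g \<omega> = H (\<lambda>s\<in>{..<t}. X s \<omega>)"
proof
  fix \<omega> assume \<omega>: "\<omega> \<in> space P"
  let ?h = "\<lambda>\<omega>. \<lambda>s\<in>{..<t}. X s \<omega>"
  define \<omega>' where "\<omega>' = (SOME \<omega>'. \<omega>' \<in> space P \<and> ?h \<omega>' = ?h \<omega>)"
  have "\<omega>' \<in> space P \<and> ?h \<omega>' = ?h \<omega>" unfolding \<omega>'_def by (rule someI) (use \<omega> in simp)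
  moreover from this have "X s \<omega>' = X s \<omega>" if "s < t" for s
    using that by (metis lessThan_iff restrict_apply')
  ultimately have "g \<omega>' = g \<omega>" using assms \<omega> unfolding history_determined_def by blast
  then show "g \<omega> = (\<lambda>l. g (SOME \<omega>'. \<omega>' \<in> space P \<and> ?h \<omega>' = l)) (?h \<omega>)"
    by (simp add: \<omega>'_def)
qed

lemma history_determined_comp:
  "history_determined P X t g \<Longrightarrow> history_determined P X t (\<lambda>\<omega>. h (g \<omega>))"
  unfolding history_determined_def by metis

context prob_space
begin

text \<open>Histories over a finite alphabet form a finite set with discrete product sigma-algebra,
  so every factor \<open>H\<close> is measurable and bounded on them.\<close>

lemma integrable_history_determined:
  fixes g :: "'a \<Rightarrow> real"
  assumes A: "finite A" and X: "\<And>s. X s \<in> measurable M (count_space A)"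
    and g: "history_determined M X t g"
  shows "integrable M g"
proof -
  obtain H where H: "\<And>\<omega>. \<omega> \<in> space M \<Longrightarrow> g \<omega> = H (\<lambda>s\<in>{..<t}. X s \<omega>)"
    using g by (rule history_determined_factor) blast
  have "(\<lambda>\<omega>. \<lambda>s\<in>{..<t}. X s \<omega>) \<in> measurable M (PiM {..<t} (\<lambda>_. count_space A))"
    by (intro measurable_restrict X)
  also have "PiM {..<t} (\<lambda>_. count_space A) = count_space (PiE {..<t} (\<lambda>_. A))"
    using A by (intro count_space_PiM_finite) (auto intro: countable_finite)
  finally have h: "(\<lambda>\<omega>. \<lambda>s\<in>{..<t}. X s \<omega>) \<in> measurable M (count_space (PiE {..<t} (\<lambda>_. A)))" .
  have "integrable M (\<lambda>\<omega>. H (\<lambda>s\<in>{..<t}. X s \<omega>))"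
  proof (rule integrable_const_bound)
    show "AE \<omega> in M. norm (H (\<lambda>s\<in>{..<t}. X s \<omega>)) \<le> (\<Sum>l\<in>PiE {..<t} (\<lambda>_. A). norm (H l))"
      using measurable_space[OF h] A
      by (intro AE_I2 member_le_sum[where f = "\<lambda>l. norm (H l)"]) (auto intro!: finite_PiE)
    show "(\<lambda>\<omega>. H (\<lambda>s\<in>{..<t}. X s \<omega>)) \<in> borel_measurable M"
      using h by (rule measurable_compose) simp
  qed
  then show ?thesis by (subst Bochner_Integration.integrable_cong[OF refl H])
qed

text \<open>The tower property for a fresh index: splitting by the value of \<open>X t\<close> gives
  products of an indicator and a function of the past, whose expectations factor by
  independence.\<close>

lemma expectation_history_determined:
  fixes G :: "'b \<Rightarrow> 'a \<Rightarrow> real"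
  assumes A: "finite A" and indep: "indep_vars (\<lambda>_. count_space A) X UNIV"
    and uniform: "distr M (count_space A) (X t) = uniform_count_measure A"
    and G: "\<And>i. i \<in> A \<Longrightarrow> history_determined M X t (G i)"
  shows "expectation (\<lambda>\<omega>. G (X t \<omega>) \<omega>) = expectation (\<lambda>\<omega>. 1 / real (card A) * (\<Sum>i\<in>A. G i \<omega>))"
proof -
  have X: "X s \<in> measurable M (count_space A)" for s using indep by (simp add: indep_vars_def)
  have int: "integrable M (G i)" if "i \<in> A" for i
    using A X G[OF that] by (rule integrable_history_determined)
  define Z where "Z i \<omega> = (if X t \<omega> = i then 1 else 0 :: real)" for i \<omega>
  have meas_Z: "Z i \<in> borel_measurable M" for i
    unfolding Z_def using X by (rule measurable_compose) simp
  have int_Z: "integrable M (Z i)" for i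
    by (rule integrable_const_bound[of _ 1, OF _ meas_Z]) (auto simp: Z_def)
  have exp_Z: "expectation (Z i) = 1 / real (card A)" if "i \<in> A" for i
  proof -
    have "Z i = (\<lambda>\<omega>. indicat_real {i} (X t \<omega>))" by (auto simp: Z_def fun_eq_iff)
    then have "expectation (Z i) = (\<integral>y. indicat_real {i} y \<partial>distr M (count_space A) (X t))"
      by (simp add: integral_distr[OF X] del: Bochner_Integration.integral_indicator)
    also have "\<dots> = measure (uniform_count_measure A) {i}"
      unfolding uniform using that by (simp add: space_uniform_count_measure)
    also have "\<dots> = 1 / real (card A)"
      using that A by (simp add: measure_uniform_count_measure)
    finally show ?thesis .
  qed
  have prod: "integrable M (\<lambda>\<omega>. Z i \<omega> * G i \<omega>)"
    "expectation (\<lambda>\<omega>. Z i \<omega> * G i \<omega>) = 1 / real (card A) * expectation (G i)" if i: "i \<in> A" for i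
  proof -
    obtain H where H: "\<And>\<omega>. \<omega> \<in> space M \<Longrightarrow> G i \<omega> = H (\<lambda>s\<in>{..<t}. X s \<omega>)"
      using G[OF i] by (rule history_determined_factor) blast
    have count: "PiM S (\<lambda>_. count_space A) = count_space (PiE S (\<lambda>_. A))" if "finite S" for S :: "nat set"
      using A that by (intro count_space_PiM_finite) (auto intro: countable_finite)
    \<comment> \<open>Disjoint blocks of an independent family are independent, and composing each
      block with a function preserves this.\<close>
    have "indep_var borel ((\<lambda>l. if l t = i then 1 else 0 :: real) \<circ> (\<lambda>\<omega>. \<lambda>s\<in>{t}. X s \<omega>))
        borel (H \<circ> (\<lambda>\<omega>. \<lambda>s\<in>{..<t}. X s \<omega>))"
      by (rule indep_var_compose[OF indep_var_restrict[OF indep, of "{t}" "{..<t}"]]) (auto simp: count)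
    then have ind: "indep_var borel (Z i) borel (\<lambda>\<omega>. H (\<lambda>s\<in>{..<t}. X s \<omega>))"
      by (simp add: comp_def Z_def[abs_def])
    have int_H: "integrable M (\<lambda>\<omega>. H (\<lambda>s\<in>{..<t}. X s \<omega>))"
      using int[OF i] by (subst Bochner_Integration.integrable_cong[OF refl H[symmetric]])
    show "integrable M (\<lambda>\<omega>. Z i \<omega> * G i \<omega>)"
      using indep_var_integrable[OF ind int_Z int_H] H
      by (simp cong: Bochner_Integration.integrable_cong)
    show "expectation (\<lambda>\<omega>. Z i \<omega> * G i \<omega>) = 1 / real (card A) * expectation (G i)"
      using indep_var_lebesgue_integral[OF ind int_Z int_H] H exp_Z[OF i]
      by (simp cong: Bochner_Integration.integral_cong)
  qed
  have "expectation (\<lambda>\<omega>. G (X t \<omega>) \<omega>) = expectation (\<lambda>\<omega>. \<Sum>i\<in>A. Z i \<omega> * G i \<omega>)"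
  proof (rule Bochner_Integration.integral_cong[OF refl])
    fix \<omega> assume "\<omega> \<in> space M"
    then have "X t \<omega> \<in> A" using measurable_space[OF X] by simp
    then show "G (X t \<omega>) \<omega> = (\<Sum>i\<in>A. Z i \<omega> * G i \<omega>)"
      using A by (simp add: Z_def if_distrib[of "\<lambda>z. z * _"] cong: if_cong)
  qed
  also have "\<dots> = (\<Sum>i\<in>A. 1 / real (card A) * expectation (G i))"
    using prod by (simp add: Bochner_Integration.integral_sum)
  also have "\<dots> = expectation (\<lambda>\<omega>. 1 / real (card A) * (\<Sum>i\<in>A. G i \<omega>))"
    using int by (simp add: Bochner_Integration.integral_sum sum_distrib_left)
  finally show ?thesis .
qed

end

section \<open>Assembly of the convergence rate\<close>

lemma convex_on_sum_functions:
  assumes "\<And>i. i \<in> I \<Longrightarrow> convex_on S (f i)" "finite I" "convex S"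
  shows "convex_on S (\<lambda>y. \<Sum>i\<in>I. f i y)"
  using assms(2,1) by (induction rule: finite_induct) (auto simp: convex_on_add convex_on_const assms(3))

text \<open>Integrability belongs to the conclusion because \<open>expectation\<close> of a
  non-integrable function is 0, which would make the bound void.\<close>

theorem corollary4p18:
  fixes n :: nat
    and f :: "nat \<Rightarrow> 'a::{real_inner, polish_space} \<Rightarrow> real"
    and F :: "'a \<Rightarrow> real"
    and L \<alpha> M :: real
    and P :: "'w measure"
    and idx :: "nat \<Rightarrow> 'w \<Rightarrow> nat"
    and x :: "nat \<Rightarrow> 'w \<Rightarrow> 'a"
    and \<phi> :: "nat \<Rightarrow> nat \<Rightarrow> 'w \<Rightarrow> 'a"
    and x0 xstar :: 'a
    and k :: nat
  assumes n: "n \<ge> 1"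
    and F: "\<And>y. F y = 1 / real n * (\<Sum>i=1..n. f i y)"
    and argmin: "argmin_set F \<noteq> {}"
    and convex: "\<And>i. i \<in> {1..n} \<Longrightarrow> convex_on UNIV (f i)"
    and L: "L > 0"
    and smooth: "\<And>i. i \<in> {1..n} \<Longrightarrow> smooth_with L (f i)"
    and P: "prob_space P"
    and indep: "prob_space.indep_vars P (\<lambda>_. count_space {1..n}) idx UNIV"
    and uniform: "\<And>t. distr P (count_space {1..n}) (idx t) = uniform_count_measure {1..n}"
    and x_0: "\<And>\<omega>. \<omega> \<in> space P \<Longrightarrow> x 0 \<omega> = x0"
    and phi_0: "\<And>i \<omega>. i \<in> {1..n} \<Longrightarrow> \<omega> \<in> space P \<Longrightarrow> \<phi> 0 i \<omega> = x0"
    and x_Suc: "\<And>t \<omega>. \<omega> \<in> space P \<Longrightarrow>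
       x (Suc t) \<omega> = prox (\<lambda>y. \<alpha> * f (idx t \<omega>) y)
         (x t \<omega> + \<alpha> *\<^sub>R grad (f (idx t \<omega>)) (\<phi> t (idx t \<omega>) \<omega>)
            - (\<alpha> / real n) *\<^sub>R (\<Sum>i=1..n. grad (f i) (\<phi> t i \<omega>)))"
    and phi_Suc: "\<And>t i \<omega>. i \<in> {1..n} \<Longrightarrow> \<omega> \<in> space P \<Longrightarrow>
       \<phi> (Suc t) i \<omega> = \<phi> t i \<omega> + (if i = idx t \<omega> then 1 else 0) *\<^sub>R (x t \<omega> - \<phi> t i \<omega>)"
    and M: "M \<ge> 2 * real n"
    and alpha_pos: "\<alpha> > 0"
    and alpha_less: "\<alpha> < 1 / (L * (2 + M / real n))"
    and xstar: "xstar \<in> argmin_set F" "norm (x0 - xstar) = infdist x0 (argmin_set F)"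
    and k: "k \<ge> 1"
  shows "integrable P (\<lambda>\<omega>. F ((1 / real k) *\<^sub>R (\<Sum>t<k. x t \<omega>)) - (INF y. F y)) \<and>
    prob_space.expectation P (\<lambda>\<omega>. F ((1 / real k) *\<^sub>R (\<Sum>t<k. x t \<omega>)) - (INF y. F y))
      \<le> ((infdist x0 (argmin_set F))\<^sup>2
           + \<alpha>\<^sup>2 * M * prob_space.expectation P
               (\<lambda>\<omega>. 1 / real n * (\<Sum>i=1..n. (norm (grad (f i) (\<phi> 0 i \<omega>) - grad (f i) xstar))\<^sup>2)))
         / (2 * \<alpha> * real k * (1 - \<alpha> * L * (2 + M / real n)))"
proof -
  interpret prob_space P by (rule P)
  define c where "c = 1 - \<alpha> * L * (2 + M / real n)"
  define G where "G i = grad (f i)" for i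
  define S where "S t \<omega> = 1 / real n * (\<Sum>j=1..n. (norm (G j (\<phi> t j \<omega>) - G j xstar))\<^sup>2)" for t \<omega>
  define V where "V t \<omega> = (norm (x t \<omega> - xstar))\<^sup>2 + \<alpha>\<^sup>2 * M * S t \<omega>" for t \<omega>
  define gap where "gap y = F y - F xstar" for y
  have "M / real n \<ge> 0" using M by simp
  then have "\<alpha> * (L * (2 + M / real n)) < 1"
    using alpha_less L by (simp add: pos_less_divide_eq)
  \<comment> \<open>The step-size condition enters here: \<open>c\<close> scales the expected
    decrease in \<open>step\<close> and is divided by at the end.\<close>
  then have c: "c > 0" by (simp add: c_def mult.assoc)
  have grad: "GDERIV (f i) y :> G i y" if "i \<in> {1..n}" for i y
    unfolding G_def using smooth[OF that] by (intro GDERIV_grad) (simp add: smooth_with_def)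
  have lip: "norm (G i y - G i z) \<le> L * norm (y - z)" if "i \<in> {1..n}" for i y z
    using smooth[OF that] by (simp add: smooth_with_def G_def)
  have F_eq: "F = (\<lambda>y. 1 / real n * (\<Sum>i=1..n. f i y))" using F by (simp add: fun_eq_iff)
  have F_min: "F xstar \<le> F y" for y
    using xstar(1) by (simp add: argmin_set_def is_arg_min_linorder)
  then have Inf: "(INF y. F y) = F xstar" by (intro cInf_eq_minimum) auto
  have "convex_on UNIV (\<lambda>y. \<Sum>i=1..n. f i y)"
    using convex by (intro convex_on_sum_functions) auto
  then have convex_F: "convex_on UNIV F"
    unfolding F_eq by (intro convex_on_cmul) auto
  \<comment> \<open>First-order optimality of \<open>F\<close> at \<open>xstar\<close>, tested on
    the gradient sum itself.\<close>
  have stationary: "(\<Sum>i=1..n. G i xstar) = 0"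
  proof -
    have "(F has_derivative (\<lambda>h. 1 / real n * (\<Sum>i=1..n. h \<bullet> G i xstar))) (at xstar)"
      unfolding F_eq using grad unfolding gderiv_def
      by (intro has_derivative_mult_right has_derivative_sum) auto
    then have "(\<lambda>h. 1 / real n * (\<Sum>i=1..n. h \<bullet> G i xstar)) = (\<lambda>h. 0)"
      by (rule has_derivative_local_min) (simp add: F_min)
    from fun_cong[OF this, of "\<Sum>i=1..n. G i xstar"]
    have "(\<Sum>i=1..n. G i xstar) \<bullet> (\<Sum>i=1..n. G i xstar) = 0"
      using n by (simp add: inner_sum_right)
    then show ?thesis by simp
  qed

  have idx: "idx t \<in> measurable P (count_space {1..n})" for t
    using indep by (simp add: indep_vars_def)
  have idx_in: "idx t \<omega> \<in> {1..n}" if "\<omega> \<in> space P" for t \<omega>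
    using measurable_space[OF idx that] by simp
  \<comment> \<open>The draw \<open>idx t\<close> first acts in passing to time
    \<open>Suc t\<close>, hence the strict bound on \<open>s\<close>. Slots are compared on
    \<open>{1..n}\<close>, where their recursion is given.\<close>
  have state: "x t \<omega> = x t \<omega>' \<and> (\<forall>i\<in>{1..n}. \<phi> t i \<omega> = \<phi> t i \<omega>')"
    if "\<omega> \<in> space P" "\<omega>' \<in> space P" "\<forall>s<t. idx s \<omega> = idx s \<omega>'" for t \<omega> \<omega>'
    using that(3)
  proof (induction t)
    case 0
    then show ?case using that(1,2) by (simp add: x_0 phi_0)
  next
    case (Suc t)
    then have IH: "x t \<omega> = x t \<omega>'" "\<And>i. i \<in> {1..n} \<Longrightarrow> \<phi> t i \<omega> = \<phi> t i \<omega>'"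
      and i: "idx t \<omega> = idx t \<omega>'" by auto
    have "(\<Sum>i=1..n. grad (f i) (\<phi> t i \<omega>)) = (\<Sum>i=1..n. grad (f i) (\<phi> t i \<omega>'))"
      using IH(2) by (intro sum.cong) auto
    moreover have "\<phi> t (idx t \<omega>') \<omega> = \<phi> t (idx t \<omega>') \<omega>'"
      by (rule IH(2)[OF idx_in[OF that(2)]])
    ultimately have "x (Suc t) \<omega> = x (Suc t) \<omega>'"
      by (simp only: x_Suc[OF that(1)] x_Suc[OF that(2)] IH(1) i)
    moreover have "\<phi> (Suc t) j \<omega> = \<phi> (Suc t) j \<omega>'" if "j \<in> {1..n}" for j
      by (simp only: phi_Suc[OF that \<open>\<omega> \<in> space P\<close>] phi_Suc[OF that \<open>\<omega>' \<in> space P\<close>] IH(1) IH(2)[OF that] i)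
    ultimately show ?case by blast
  qed
  have det_x: "history_determined P idx t (x t)" for t
    using state unfolding history_determined_def by blast
  note integrable = integrable_history_determined[OF finite_atLeastAtMost idx]

  \<comment> \<open>The value that \<open>V (Suc t)\<close> would take if index \<open>i\<close>
    were drawn. With \<open>i\<close> as a parameter it depends on the history before
    \<open>t\<close> only, as the tower property demands.\<close>
  define V' where "V' t i \<omega> = 
        (norm (prox (\<lambda>y. \<alpha> * f i y)
           (x t \<omega> + \<alpha> *\<^sub>R G i (\<phi> t i \<omega>) - (\<alpha> / real n) *\<^sub>R (\<Sum>j=1..n. G j (\<phi> t j \<omega>))) - xstar))\<^sup>2
        + \<alpha>\<^sup>2 * M * (1 / real n * (\<Sum>j=1..n.
            (norm (G j (\<phi> t j \<omega> + (if j = i then 1 else 0) *\<^sub>R (x t \<omega> - \<phi> t j \<omega>)) - G j xstar))\<^sup>2))"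
    for t i \<omega>
  have V_Suc: "V (Suc t) \<omega> = V' t (idx t \<omega>) \<omega>" if "\<omega> \<in> space P" for t \<omega>
    using that by (simp add: V_def V'_def S_def x_Suc phi_Suc G_def)
  have sum_real_cong: "(\<Sum>j=1..n. h j (\<phi> t j \<omega>)) = (\<Sum>j=1..n. h j (\<phi> t j \<omega>'))"
    if "\<omega> \<in> space P" "\<omega>' \<in> space P" "\<forall>s<t. idx s \<omega> = idx s \<omega>'"
    for t \<omega> \<omega>' and h :: "nat \<Rightarrow> 'a \<Rightarrow> real"
    using state[OF that] by (intro sum.cong) auto
  have sum_vec_cong: "(\<Sum>j=1..n. h j (\<phi> t j \<omega>)) = (\<Sum>j=1..n. h j (\<phi> t j \<omega>'))"
    if "\<omega> \<in> space P" "\<omega>' \<in> space P" "\<forall>s<t. idx s \<omega> = idx s \<omega>'"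
    for t \<omega> \<omega>' and h :: "nat \<Rightarrow> 'a \<Rightarrow> 'a"
    using state[OF that] by (intro sum.cong) auto
  have det_V: "history_determined P idx t (V t)" for t
    unfolding history_determined_def
  proof (intro ballI impI)
    fix \<omega> \<omega>' assume hist: "\<omega> \<in> space P" "\<omega>' \<in> space P" "\<forall>s<t. idx s \<omega> = idx s \<omega>'"
    from state[OF hist] sum_real_cong[OF hist, of "\<lambda>j y. (norm (G j y - G j xstar))\<^sup>2"]
    show "V t \<omega> = V t \<omega>'" unfolding V_def S_def by (simp only:)
  qed
  have det_V': "history_determined P idx t (V' t i)" if "i \<in> {1..n}" for t i
    unfolding history_determined_def
  proof (intro ballI impI)
    fix \<omega> \<omega>' assume hist: "\<omega> \<in> space P" "\<omega>' \<in> space P" "\<forall>s<t. idx s \<omega> = idx s \<omega>'"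
    have "x t \<omega> = x t \<omega>'" "\<phi> t i \<omega> = \<phi> t i \<omega>'" using state[OF hist] that by auto
    then show "V' t i \<omega> = V' t i \<omega>'"
      unfolding V'_def
      using sum_vec_cong[OF hist, of G]
        sum_real_cong[OF hist, of "\<lambda>j y. (norm (G j (y + (if j = i then 1 else 0) *\<^sub>R (x t \<omega>' - y)) - G j xstar))\<^sup>2"]
      by (simp only:)
  qed
  have int_gap: "integrable P (\<lambda>\<omega>. gap (x t \<omega>))" for t
    by (rule integrable[OF history_determined_comp[OF det_x]])
  have step: "expectation (V (Suc t)) \<le> expectation (V t) - 2 * \<alpha> * c * expectation (\<lambda>\<omega>. gap (x t \<omega>))" for t
  proof -
    have "expectation (V (Suc t)) = expectation (\<lambda>\<omega>. V' t (idx t \<omega>) \<omega>)"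
      by (intro Bochner_Integration.integral_cong refl V_Suc)
    also have "\<dots> = expectation (\<lambda>\<omega>. 1 / real (card {1..n}) * (\<Sum>i=1..n. V' t i \<omega>))"
      by (rule expectation_history_determined[OF _ indep uniform det_V']) auto
    also have "\<dots> \<le> expectation (\<lambda>\<omega>. V t \<omega> - 2 * \<alpha> * c * gap (x t \<omega>))"
    proof (rule integral_mono)
      show "integrable P (\<lambda>\<omega>. 1 / real (card {1..n}) * (\<Sum>i=1..n. V' t i \<omega>))"
        by (intro integrable_mult_right Bochner_Integration.integrable_sum integrable[OF det_V'])
      show "integrable P (\<lambda>\<omega>. V t \<omega> - 2 * \<alpha> * c * gap (x t \<omega>))"
        by (intro Bochner_Integration.integrable_diff integrable_mult_right integrable[OF det_V] int_gap)
      fix \<omega> assume "\<omega> \<in> space P"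
      have "gap (x t \<omega>) = 1 / real n * (\<Sum>j=1..n. f j (x t \<omega>) - f j xstar)"
        by (simp add: gap_def F_eq sum_subtractf right_diff_distrib)
      then show "1 / real (card {1..n}) * (\<Sum>i=1..n. V' t i \<omega>) \<le> V t \<omega> - 2 * \<alpha> * c * gap (x t \<omega>)"
        using sapa_step[OF n convex grad lip L _ M stationary, of \<alpha> "x t \<omega>" "\<lambda>j. \<phi> t j \<omega>"] alpha_pos
        by (simp only: V'_def V_def S_def c_def card_atLeastAtMost) simp
    qed
    also have "\<dots> = expectation (V t) - 2 * \<alpha> * c * expectation (\<lambda>\<omega>. gap (x t \<omega>))"
      using integrable[OF det_V] int_gap by simp
    finally show ?thesis .
  qed
  \<comment> \<open>Keeping \<open>V T\<close> on the left closes the induction; its nonnegativity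
    discards it afterwards.\<close>
  have telescope: "2 * \<alpha> * c * (\<Sum>t<T. expectation (\<lambda>\<omega>. gap (x t \<omega>))) + expectation (V T) \<le> expectation (V 0)" for T
  proof (induction T)
    case (Suc T)
    then show ?case using step[of T] by (simp add: algebra_simps)
  qed simp
  have "0 \<le> V k \<omega>" for \<omega>
    unfolding V_def S_def using M by (intro add_nonneg_nonneg mult_nonneg_nonneg sum_nonneg) auto
  then have "0 \<le> expectation (V k)" by (intro Bochner_Integration.integral_nonneg) simp
  with telescope[of k]
  have sum_gap: "2 * \<alpha> * c * (\<Sum>t<k. expectation (\<lambda>\<omega>. gap (x t \<omega>))) \<le> expectation (V 0)" by linarith

  have S0: "S 0 \<omega> = 1 / real n * (\<Sum>j=1..n. (norm (G j x0 - G j xstar))\<^sup>2)" if "\<omega> \<in> space P" for \<omega>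
    using that by (simp add: S_def phi_0)
  have V0: "expectation (V 0) = (infdist x0 (argmin_set F))\<^sup>2 + \<alpha>\<^sup>2 * M * expectation (S 0)"
  proof -
    have "expectation (V 0) = expectation (\<lambda>\<omega>. (infdist x0 (argmin_set F))\<^sup>2 + \<alpha>\<^sup>2 * M * S 0 \<omega>)"
      using xstar(2) by (intro Bochner_Integration.integral_cong) (simp_all add: V_def x_0)
    moreover have "integrable P (S 0)"
      using integrable_const by (subst Bochner_Integration.integrable_cong[OF refl S0])
    ultimately show ?thesis by (simp add: prob_space)
  qed

  define avg where "avg \<omega> = (1 / real k) *\<^sub>R (\<Sum>t<k. x t \<omega>)" for \<omega>
  have "history_determined P idx k avg"
    unfolding history_determined_def avg_def
  proof (intro ballI impI)
    fix \<omega> \<omega>' assume "\<omega> \<in> space P" "\<omega>' \<in> space P" "\<forall>s<k. idx s \<omega> = idx s \<omega>'"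
    then have "x t \<omega> = x t \<omega>'" if "t < k" for t
      using state[of \<omega> \<omega>' t] that by auto
    then show "(1 / real k) *\<^sub>R (\<Sum>t<k. x t \<omega>) = (1 / real k) *\<^sub>R (\<Sum>t<k. x t \<omega>')" by simp
  qed
  then have int_avg: "integrable P (\<lambda>\<omega>. gap (avg \<omega>))"
    by (intro integrable[OF history_determined_comp])
  \<comment> \<open>Jensen at each sample point, with weights \<open>1 / real k\<close> that sum to
    1 since \<open>k \<ge> 1\<close>.\<close>
  have jensen: "gap (avg \<omega>) \<le> 1 / real k * (\<Sum>t<k. gap (x t \<omega>))" for \<omega>
  proof -
    have "F (\<Sum>t<k. (1 / real k) *\<^sub>R x t \<omega>) \<le> (\<Sum>t<k. 1 / real k * F (x t \<omega>))"
      using k by (intro convex_on_sum[OF _ _ convex_F]) (auto simp: lessThan_empty_iff)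
    then show ?thesis
      using k by (simp add: gap_def avg_def sum_subtractf scaleR_sum_right right_diff_distrib sum_distrib_left)
  qed
  have "expectation (\<lambda>\<omega>. gap (avg \<omega>)) \<le> expectation (\<lambda>\<omega>. 1 / real k * (\<Sum>t<k. gap (x t \<omega>)))"
    using int_avg int_gap jensen
    by (intro integral_mono integrable_mult_right Bochner_Integration.integrable_sum)
  also have "\<dots> = 1 / real k * (\<Sum>t<k. expectation (\<lambda>\<omega>. gap (x t \<omega>)))"
    using int_gap by (simp add: Bochner_Integration.integral_sum)
  also have "\<dots> \<le> expectation (V 0) / (2 * \<alpha> * real k * c)"
    using sum_gap k c alpha_pos by (simp add: field_simps)
  finally show ?thesis
    using int_avg unfolding V0 Inf c_def gap_def avg_def S_def G_def by simp
qed

end
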